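(* Let $\mathcal{K}^n$ be the set of convex bodies in $\mathbb{R}^n$ and $\mathcal{P}^n$ the set of symmetric positive-definite real $n\times n$ matrices. The function $(P^*, z^* ): \mathcal{K}^n\times\mathcal{K}^n \to \mathcal{P}^n\times\mathbb{R}^n$, defined such that $P^*(K,L)L + z^*(K,L)$ is the positive John image of $L$ in $K$, is continuous with respect to the Hausdorff metric on $\mathcal{K}^n$.
   Context: A convex body is a compact convex set with nonempty interior. A positive image of $L$ in $K$ is a set $PL+z\subset K$ with $P\in\mathcal{P}^n$, $z\in\mathbb{R}^n$. The positive John image of $L$ in $K$ is the unique positive image of $L$ in $K$ of maximal volume; the pair $(P,z)$ realizing it is also unique. The Hausdorff metric is $\delta(K,L) = \inf\{d>0 : L\subset K + dB_2^n,\ K\subset L+dB_2^n\}$, with $B_2^n$ the Euclidean unit ball. *)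

theory Defs
  imports "HOL-Analysis.Analysis"
begin

typedef (overloaded) 'n convex_body =
  "{K :: (real^'n::finite) set. compact K \<and> convex K \<and> interior K \<noteq> {}}"
  morphisms body Convex_Body
proof
  have "interior (cball (0::real^'n) 1) \<noteq> {}" by simp
  then show "cball 0 1 \<in> {K :: (real^'n) set. compact K \<and> convex K \<and> interior K \<noteq> {}}"
    by (simp del: interior_cball)
qed

lemma compact_body: "compact (body K)"
  and convex_body: "convex (body K)"
  and interior_body: "interior (body K) \<noteq> {}"
  using body[of K] by auto

lemma body_nonempty: "body K \<noteq> {}"
  using interior_body interior_subset by blast

definition hausdorff_admissible :: "'a::real_normed_vector set \<Rightarrow> 'a set \<Rightarrow> real set" where
  "hausdorff_admissible K L =
     {d. d > 0 \<and> L \<subseteq> K + (*\<^sub>R) d ` cball 0 1 \<and> K \<subseteq> L + (*\<^sub>R) d ` cball 0 1}"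

definition hausdorff_dist :: "'a::real_normed_vector set \<Rightarrow> 'a set \<Rightarrow> real" where
  "hausdorff_dist K L = Inf (hausdorff_admissible K L)"

lemma in_plus_scaled_ball:
  fixes x :: "'a::real_normed_vector"
  assumes "d > 0"
  shows "x \<in> K + (*\<^sub>R) d ` cball 0 1 \<longleftrightarrow> (\<exists>y\<in>K. dist x y \<le> d)"
proof -
  have "(*\<^sub>R) d ` cball (0::'a) 1 = cball 0 d"
    using assms cball_scale[of d 0 1] by simp
  moreover have "x \<in> K + cball 0 d \<longleftrightarrow> (\<exists>y\<in>K. dist x y \<le> d)"
  proof
    assume "x \<in> K + cball 0 d"
    then obtain y z where "x = y + z" "y \<in> K" "z \<in> cball 0 d"
      by (rule set_plus_elim)
    then show "\<exists>y\<in>K. dist x y \<le> d"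
      by (auto simp: dist_norm intro!: bexI[of _ y])
  next
    assume "\<exists>y\<in>K. dist x y \<le> d"
    then obtain y where "y \<in> K" "dist x y \<le> d" by blast
    then have "y + (x - y) \<in> K + cball 0 d"
      by (intro set_plus_intro) (auto simp: dist_norm norm_minus_commute)
    then show "x \<in> K + cball 0 d" by simp
  qed
  ultimately show ?thesis by simp
qed

lemma hausdorff_admissible_iff:
  "d \<in> hausdorff_admissible K L \<longleftrightarrow>
     d > 0 \<and> (\<forall>x\<in>L. \<exists>y\<in>K. dist x y \<le> d) \<and> (\<forall>x\<in>K. \<exists>y\<in>L. dist x y \<le> d)"
  unfolding hausdorff_admissible_def by (auto simp: subset_iff in_plus_scaled_ball)

lemma hausdorff_admissibleD:
  assumes "d \<in> hausdorff_admissible K L"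
  shows "d > 0" "x \<in> L \<Longrightarrow> \<exists>y\<in>K. dist x y \<le> d" "x \<in> K \<Longrightarrow> \<exists>y\<in>L. dist x y \<le> d"
  using assms by (simp_all only: hausdorff_admissible_iff)

lemma hausdorff_admissibleI:
  assumes "d > 0" "\<And>x. x \<in> L \<Longrightarrow> \<exists>y\<in>K. dist x y \<le> d" "\<And>x. x \<in> K \<Longrightarrow> \<exists>y\<in>L. dist x y \<le> d"
  shows "d \<in> hausdorff_admissible K L"
  unfolding hausdorff_admissible_iff using assms by simp

lemma hausdorff_admissible_bdd_below: "bdd_below (hausdorff_admissible K L)"
  by (rule bdd_belowI[of _ 0]) (simp add: hausdorff_admissible_def)

lemma hausdorff_admissible_nonempty:
  assumes "bounded K" "bounded L" "K \<noteq> {}" "L \<noteq> {}"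
  shows "hausdorff_admissible K L \<noteq> {}"
proof -
  obtain e where e: "\<And>x y. x \<in> K \<union> L \<Longrightarrow> y \<in> K \<union> L \<Longrightarrow> dist x y \<le> e"
    using assms(1,2) bounded_two_points[of "K \<union> L"] by auto
  obtain k l where "k \<in> K" "l \<in> L" using assms(3,4) by blast
  then have "(\<forall>x\<in>L. dist x k \<le> max e 1)" "(\<forall>x\<in>K. dist x l \<le> max e 1)"
    using e by (meson UnCI le_max_iff_disj)+
  then have "max e 1 \<in> hausdorff_admissible K L"
    unfolding hausdorff_admissible_iff using \<open>k \<in> K\<close> \<open>l \<in> L\<close>
    by (intro conjI ballI) (simp, blast+)
  then show ?thesis by blast
qed

lemma hausdorff_dist_nonneg:
  assumes "bounded K" "bounded L" "K \<noteq> {}" "L \<noteq> {}"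
  shows "0 \<le> hausdorff_dist K L"
  unfolding hausdorff_dist_def
  by (rule cInf_greatest[OF hausdorff_admissible_nonempty[OF assms]]) (simp add: hausdorff_admissible_def)

lemma hausdorff_dist_commute: "hausdorff_dist K L = hausdorff_dist L K"
  unfolding hausdorff_dist_def hausdorff_admissible_def by (simp only: conj_ac)

lemma hausdorff_dist_less:
  assumes "bounded K" "bounded L" "K \<noteq> {}" "L \<noteq> {}" "hausdorff_dist K L < e"
  shows "\<exists>d<e. d \<in> hausdorff_admissible K L"
  using cInf_lessD[OF hausdorff_admissible_nonempty[OF assms(1-4)]] assms(5)
  unfolding hausdorff_dist_def by blast

lemma hausdorff_dist_le: "d \<in> hausdorff_admissible K L \<Longrightarrow> hausdorff_dist K L \<le> d"
  unfolding hausdorff_dist_def by (rule cInf_lower[OF _ hausdorff_admissible_bdd_below])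

lemma hausdorff_dist_triangle:
  assumes "bounded K" "bounded L" "bounded M" "K \<noteq> {}" "L \<noteq> {}" "M \<noteq> {}"
  shows "hausdorff_dist K M \<le> hausdorff_dist K L + hausdorff_dist L M"
proof (rule field_le_epsilon)
  fix e :: real assume "e > 0"
  obtain a where a: "a < hausdorff_dist K L + e/2" "a \<in> hausdorff_admissible K L"
    using hausdorff_dist_less[OF assms(1,2,4,5), of "hausdorff_dist K L + e/2"] \<open>e > 0\<close>
    unfolding less_add_same_cancel1 by (meson half_gt_zero)
  obtain b where b: "b < hausdorff_dist L M + e/2" "b \<in> hausdorff_admissible L M"
    using hausdorff_dist_less[OF assms(2,3,5,6), of "hausdorff_dist L M + e/2"] \<open>e > 0\<close>
    unfolding less_add_same_cancel1 by (meson half_gt_zero)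
  have "a + b \<in> hausdorff_admissible K M"
  proof (rule hausdorff_admissibleI)
    show "a + b > 0"
      using a(2) b(2) by (intro add_pos_pos hausdorff_admissibleD(1))
  next
    fix x assume "x \<in> M"
    then obtain y where y: "y \<in> L" "dist x y \<le> b"
      using hausdorff_admissibleD(2)[OF b(2)] by blast
    then obtain z where z: "z \<in> K" "dist y z \<le> a"
      using hausdorff_admissibleD(2)[OF a(2)] by blast
    have "dist x z \<le> a + b" using y(2) z(2) dist_triangle[of x z y] by linarith
    with z(1) show "\<exists>y\<in>K. dist x y \<le> a + b" by blast
  next
    fix x assume "x \<in> K"
    then obtain y where y: "y \<in> L" "dist x y \<le> a"
      using hausdorff_admissibleD(3)[OF a(2)] by blast
    then obtain z where z: "z \<in> M" "dist y z \<le> b"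
      using hausdorff_admissibleD(3)[OF b(2)] by blast
    have "dist x z \<le> a + b" using y(2) z(2) dist_triangle[of x z y] by linarith
    with z(1) show "\<exists>y\<in>M. dist x y \<le> a + b" by blast
  qed
  from hausdorff_dist_le[OF this] a(1) b(1)
  show "hausdorff_dist K M \<le> hausdorff_dist K L + hausdorff_dist L M + e" by linarith
qed

lemma hausdorff_dist_0_subset:
  assumes "closed K" "bounded K" "bounded L" "K \<noteq> {}" "L \<noteq> {}" "hausdorff_dist K L = 0"
  shows "L \<subseteq> K"
proof
  fix x assume "x \<in> L"
  have "\<exists>y\<in>K. dist y x < e" if "e > 0" for e
  proof -
    obtain d where "d < e" "d \<in> hausdorff_admissible K L"
      using hausdorff_dist_less[OF assms(2-5), of e] assms(6) \<open>e > 0\<close> by metis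
    then obtain y where "y \<in> K" "dist x y \<le> d"
      using hausdorff_admissibleD(2)[OF _ \<open>x \<in> L\<close>] by blast
    then show ?thesis
      using \<open>d < e\<close> by (intro bexI[of _ y]) (simp_all add: dist_commute)
  qed
  then have "x \<in> closure K" by (auto simp: closure_approachable)
  then show "x \<in> K" using \<open>closed K\<close> by simp
qed

lemma hausdorff_dist_self:
  assumes "bounded K" "K \<noteq> {}"
  shows "hausdorff_dist K K = 0"
proof (rule antisym)
  show "hausdorff_dist K K \<le> 0"
  proof (rule field_le_epsilon)
    fix e :: real assume "e > 0"
    have "\<exists>y\<in>K. dist x y \<le> e" if "x \<in> K" for x
      using that \<open>e > 0\<close> by (intro bexI[of _ x]) simp_all
    with \<open>e > 0\<close> have "e \<in> hausdorff_admissible K K"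
      unfolding hausdorff_admissible_iff by blast
    from hausdorff_dist_le[OF this] show "hausdorff_dist K K \<le> 0 + e" by simp
  qed
qed (use hausdorff_dist_nonneg assms in blast)

instantiation convex_body :: (finite) metric_space
begin

definition dist_convex_body :: "'a convex_body \<Rightarrow> 'a convex_body \<Rightarrow> real" where
  "dist_convex_body K L = hausdorff_dist (body K) (body L)"

definition uniformity_convex_body :: "('a convex_body \<times> 'a convex_body) filter" where
  "uniformity_convex_body = (INF e\<in>{0<..}. principal {(K, L). dist K L < e})"

definition open_convex_body :: "'a convex_body set \<Rightarrow> bool" where
  "open_convex_body U \<longleftrightarrow> (\<forall>K\<in>U. eventually (\<lambda>(K', L). K' = K \<longrightarrow> L \<in> U) uniformity)"

instance
proof
  fix K L M :: "'a convex_body"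
  note facts = compact_imp_bounded[OF compact_body] body_nonempty compact_imp_closed[OF compact_body]
  show "dist K L = 0 \<longleftrightarrow> K = L"
  proof
    assume *: "dist K L = 0"
    then have "body L \<subseteq> body K"
      unfolding dist_convex_body_def by (intro hausdorff_dist_0_subset facts)
    moreover have "body K \<subseteq> body L"
      using * unfolding dist_convex_body_def
      by (subst (asm) hausdorff_dist_commute) (intro hausdorff_dist_0_subset facts)
    ultimately show "K = L" using body_inject by blast
  qed (simp add: dist_convex_body_def hausdorff_dist_self facts)
  have "dist K L \<le> dist K M + dist M L"
    unfolding dist_convex_body_def by (intro hausdorff_dist_triangle facts)
  also have "dist M L = dist L M"
    unfolding dist_convex_body_def by (rule hausdorff_dist_commute)
  finally show "dist K L \<le> dist K M + dist L M" .
qed (simp_all add: uniformity_convex_body_def open_convex_body_def)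

end

definition pos_def_matrices :: "(real^'n^'n) set" where
  "pos_def_matrices = {P. transpose P = P \<and> (\<forall>x. x \<noteq> 0 \<longrightarrow> 0 < x \<bullet> (P *v x))}"

definition affine_image :: "real^'n^'n \<Rightarrow> real^'n \<Rightarrow> (real^'n) set \<Rightarrow> (real^'n) set" where
  "affine_image P z L = (\<lambda>x. P *v x + z) ` L"

definition positive_images :: "(real^'n) set \<Rightarrow> (real^'n) set \<Rightarrow> (real^'n) set set" where
  "positive_images K L = {affine_image P z L | P z. P \<in> pos_def_matrices \<and> affine_image P z L \<subseteq> K}"

definition is_positive_John_image :: "(real^'n) set \<Rightarrow> (real^'n) set \<Rightarrow> (real^'n) set \<Rightarrow> bool" where
  "is_positive_John_image K L E \<longleftrightarrow>
     E \<in> positive_images K L \<and>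
     (\<forall>E'\<in>positive_images K L. measure lebesgue E' \<le> measure lebesgue E)"

definition realizes_positive_John_image ::
    "'n::finite convex_body \<Rightarrow> 'n convex_body \<Rightarrow> (real^'n^'n) \<times> (real^'n) \<Rightarrow> bool" where
  "realizes_positive_John_image K L = (\<lambda>(P, z).
     P \<in> pos_def_matrices \<and> is_positive_John_image (body K) (body L) (affine_image P z (body L)))"

text \<open>The pair \<open>(P\<^sup>*, z\<^sup>*)\<close>. The definite description is meaningful because the realizing
  pair exists and is unique.\<close>

definition positive_John_map ::
    "'n::finite convex_body \<times> 'n convex_body \<Rightarrow> (real^'n^'n) \<times> (real^'n)" where
  "positive_John_map = (\<lambda>(K, L). THE Pz. realizes_positive_John_image K L Pz)"

end

theory Submission
  imports Defs
begin

text \<open>A positive image \<open>P L + z\<close> has volume \<open>det P\<close> times that of \<open>L\<close>, so the realizing pairs are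
  the maximizers of \<open>det P\<close> among the feasible pairs. Existence follows by compactness once semidefinite
  \<open>P\<close> are admitted. For uniqueness, the midpoint of two maximizers is feasible, and simultaneous
  diagonalization reduces the strict log-concavity of \<open>det\<close> to the inequality between the arithmetic
  and the geometric mean; hence the matrices agree. If the translations differed by \<open>u \<noteq> 0\<close>, then
  \<open>P + t u u\<^sup>T\<close> with small \<open>t > 0\<close> and a suitable translation would be feasible, with a larger
  determinant. For continuity, the realizing pairs along a convergent sequence of bodies are bounded.
  Contracting a feasible pair of the limit bodies towards an interior point of \<open>K\<close> makes it feasible
  for nearby bodies, so every limit of realizing pairs realizes the positive John image of the limit
  bodies and is determined by uniqueness.\<close>

subsection \<open>Volume of linear images\<close>

text \<open>The matrix arises from \<open>mat 1\<close> by adding row \<open>n\<close> to row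
  \<open>m\<close>, which preserves the determinant.\<close>

lemma det_shear:
  fixes m n :: "'n::finite"
  assumes "m \<noteq> n"
  shows "det (matrix (\<lambda>v::real^'n. \<chi> i. if i = m then v$m + v$n else v$i)) = 1"
proof -
  have "matrix (\<lambda>v::real^'n. \<chi> i. if i = m then v$m + v$n else v$i) =
      (\<chi> i. if i = m then row m (mat 1) + 1 *s row n (mat 1) else row i (mat 1))"
    by (auto simp: matrix_def row_def mat_def axis_def vec_eq_iff)
  then show ?thesis
    using det_row_operation[OF assms, of "mat 1" 1] by simp
qed

text \<open>\<open>measure_shear_interval\<close> treats nonempty boxes whose lower corner has a
  nonnegative \<open>n\<close>-th coordinate; translation invariance reduces every nonempty box to
  that case.\<close>

lemma measure_shear_cbox:
  fixes m n :: "'n::finite" and a b :: "real^'n"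
  assumes "m \<noteq> n"
  shows "measure lebesgue ((\<lambda>x. \<chi> i. if i = m then x$m + x$n else x$i) ` cbox a b)
    = measure lebesgue (cbox a b)"
proof (cases "cbox a b = {}")
  case False
  let ?h = "\<lambda>x::real^'n. \<chi> i. if i = m then x$m + x$n else x$i"
  have lin: "linear ?h"
    by (rule linearI) (auto simp: vec_eq_iff algebra_simps)
  \<comment> \<open>Adding \<open>v\<close> moves the \<open>n\<close>-th coordinate of the lower
    corner to 0.\<close>
  define v :: "real^'n" where "v = - axis n (a $ n)"
  have "?h ` cbox (v + a) (v + b) = (+) (?h v) ` ?h ` cbox a b"
    by (simp only: cbox_translation image_image linear_add[OF lin])
  then have "measure lebesgue (?h ` cbox a b) = measure lebesgue (?h ` cbox (v + a) (v + b))"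
    by (simp only: measure_translation)
  also have "\<dots> = measure lebesgue (cbox (v + a) (v + b))"
  proof (rule measure_shear_interval[OF \<open>m \<noteq> n\<close>])
    show "cbox (v + a) (v + b) \<noteq> {}"
      using False by (simp only: cbox_translation image_is_empty not_False_eq_True)
    show "0 \<le> (v + a) $ n"
      by (simp add: v_def)
  qed
  also have "\<dots> = measure lebesgue (cbox a b)"
    by (simp only: cbox_translation measure_translation)
  finally show ?thesis .
qed simp

text \<open>The swap is an involution that permutes the coordinates of both corners, so the side
  lengths are only reordered.\<close>

lemma measure_swap_cbox:
  fixes m n :: "'n::finite" and a b :: "real^'n"
  shows "measure lebesgue ((\<lambda>x. \<chi> i. x $ Transposition.transpose m n i) ` cbox a b)
    = measure lebesgue (cbox a b)"
proof (cases "cbox a b = {}")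
  case False
  let ?t = "Transposition.transpose m n"
  let ?h = "\<lambda>x::real^'n. \<chi> i. x $ ?t i"
  have h: "?h x \<in> cbox (?h u) (?h v)" if "x \<in> cbox u v" for x u v
    using that by (simp add: mem_box_cart)
  have hh: "?h (?h x) = x" for x
    by (simp add: vec_eq_iff)
  have eq: "?h ` cbox a b = cbox (?h a) (?h b)"
  proof
    show "cbox (?h a) (?h b) \<subseteq> ?h ` cbox a b"
    proof
      fix x assume "x \<in> cbox (?h a) (?h b)"
      from h[OF this] have "?h x \<in> cbox a b"
        by (simp only: hh)
      then show "x \<in> ?h ` cbox a b"
        by (rule rev_image_eqI) (simp only: hh)
    qed
  qed (use h in blast)
  then have "cbox (?h a) (?h b) \<noteq> {}"
    using False by (metis image_is_empty)
  then show ?thesis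
    using False prod.permute[OF permutes_swap_id, of m UNIV n "\<lambda>i. b $ i - a $ i"]
    by (simp add: eq content_cbox_if_cart o_def)
qed simp

lemma det_swap:
  fixes m n :: "'n::finite"
  assumes "m \<noteq> n"
  shows "det (matrix (\<lambda>x::real^'n. \<chi> i. x $ Transposition.transpose m n i)) = - 1"
proof -
  have "matrix (\<lambda>x::real^'n. \<chi> i. x $ Transposition.transpose m n i)
      = (\<chi> i. (mat 1 :: real^'n^'n) $ Transposition.transpose m n i)"
    by (auto simp: matrix_def mat_def axis_def vec_eq_iff)
  then show ?thesis
    using assms det_permute_rows[OF permutes_swap_id[of m UNIV n], of "mat 1 :: real^'n^'n"]
    by (simp add: sign_swap_id)
qed

text \<open>The library proves this only for wellordered index types, because it evaluates the
  determinant of a shear as that of a triangular matrix.\<close>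

proposition
  fixes f :: "real^'n::finite \<Rightarrow> real^'n"
  assumes "linear f" "S \<in> lmeasurable"
  shows lmeasurable_linear_image_finite: "f ` S \<in> lmeasurable"
    and measure_linear_image_finite:
      "measure lebesgue (f ` S) = \<bar>det (matrix f)\<bar> * measure lebesgue S"
proof -
  \<comment> \<open>All measurable sets are quantified over because, for a composition, the property
    of \<open>g\<close> is applied to the image under \<open>h\<close>.\<close>
  define Q where "Q = (\<lambda>f :: real^'n \<Rightarrow> real^'n. \<forall>S\<in>lmeasurable. f ` S \<in> lmeasurable \<and>
    measure lebesgue (f ` S) = \<bar>det (matrix f)\<bar> * measure lebesgue S)"
  \<comment> \<open>For swaps and shears, whose determinant is 1 or -1, it suffices to check
    boxes.\<close>
  have boxes: "Q g" if "linear g" "\<bar>det (matrix g)\<bar> = 1"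
    "\<And>a b. measure lebesgue (g ` cbox a b) = measure lebesgue (cbox a b)" for g
    unfolding Q_def using measure_linear_sufficient[OF that(1), where m = 1] that(2,3)
    by (metis mult_1)
  have "Q f"
  proof (rule induct_linear_elementary[OF \<open>linear f\<close>])
    fix g h :: "real^'n \<Rightarrow> real^'n"
    assume "linear g" "linear h" "Q g" "Q h"
    then show "Q (g \<circ> h)"
      unfolding Q_def image_comp[symmetric] matrix_compose[OF \<open>linear h\<close> \<open>linear g\<close>] det_mul abs_mult
      by (metis mult.assoc)
  next
    fix g :: "real^'n \<Rightarrow> real^'n" and i
    assume g: "linear g" "\<And>x. g x $ i = 0"
    \<comment> \<open>A map with a vanishing coordinate is not surjective, hence not injective:
      image measure and determinant are both 0.\<close>
    have "axis i 1 \<notin> range g"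
    proof
      assume "axis i 1 \<in> range g"
      then obtain x where "axis i 1 = g x" ..
      then have "axis i (1::real) $ i = 0" by (simp only: g(2))
      then show False by simp
    qed
    then have "\<not> inj g"
      using linear_injective_imp_surjective[OF g(1)] by blast
    then have "negligible (g ` S)" "det (matrix g) = 0" for S
      using negligible_linear_singular_image[OF g(1)] det_nz_iff_inj[OF g(1)] by auto
    then show "Q g"
      unfolding Q_def by (simp add: negligible_iff_measure)
  next
    fix c :: "'n \<Rightarrow> real"
    have "det (matrix (\<lambda>x::real^'n. \<chi> i. c i * x $ i)) = prod c UNIV"
      by (subst det_diagonal) (auto simp: matrix_def axis_def)
    then show "Q (\<lambda>x. \<chi> i. c i * x $ i)"
      unfolding Q_def by (simp add: measurable_stretch measure_stretch)
  next
    fix m n :: 'n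
    assume "m \<noteq> n"
    show "Q (\<lambda>x. \<chi> i. x $ Transposition.transpose m n i)"
    proof (rule boxes)
      show "linear (\<lambda>x::real^'n. \<chi> i. x $ Transposition.transpose m n i)"
        by (rule linearI) (simp_all add: vec_eq_iff)
    qed (simp_all only: det_swap[OF \<open>m \<noteq> n\<close>] measure_swap_cbox abs_minus_cancel abs_one)
    show "Q (\<lambda>x. \<chi> i. if i = m then x$m + x$n else x$i)"
    proof (rule boxes)
      show "linear (\<lambda>x::real^'n. \<chi> i. if i = m then x$m + x$n else x$i)"
        by (rule linearI) (auto simp: vec_eq_iff algebra_simps)
    qed (simp_all only: det_shear[OF \<open>m \<noteq> n\<close>] measure_shear_cbox[OF \<open>m \<noteq> n\<close>] abs_one)
  qed
  with assms(2) show "f ` S \<in> lmeasurable"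
    "measure lebesgue (f ` S) = \<bar>det (matrix f)\<bar> * measure lebesgue S"
    unfolding Q_def by auto
qed

lemma measure_affine_image:
  fixes P :: "real^'n::finite^'n"
  assumes "L \<in> lmeasurable"
  shows "measure lebesgue (affine_image P z L) = \<bar>det P\<bar> * measure lebesgue L"
proof -
  have "affine_image P z L = (+) z ` (*v) P ` L"
    unfolding affine_image_def by (simp add: image_image add.commute)
  then show ?thesis
    using measure_linear_image_finite[OF matrix_vector_mul_linear assms, of P]
    by (simp add: measure_translation)
qed

subsection \<open>Simultaneous diagonalization\<close>

lemma inner_symmetric_matrix:
  fixes B :: "real^'n::finite^'n"
  assumes "transpose B = B"
  shows "x \<bullet> (B *v y) = y \<bullet> (B *v x)"
  by (metis assms dot_lmul_matrix inner_commute transpose_matrix_vector)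

text \<open>Along \<open>v + t *\<^sub>R w\<close> the form equals
  \<open>2 * t * a + t\<^sup>2 * b\<close>. If \<open>a\<close> were nonzero, a small
  \<open>t\<close> of opposite sign would make this negative.\<close>

lemma semidefinite_null_vector:
  fixes M :: "real^'n::finite^'n"
  assumes sym: "transpose M = M" and V: "subspace V"
    and nonneg: "\<And>w. w \<in> V \<Longrightarrow> 0 \<le> w \<bullet> (M *v w)"
    and v: "v \<in> V" "v \<bullet> (M *v v) = 0" and w: "w \<in> V"
  shows "v \<bullet> (M *v w) = 0"
proof -
  define a b where "a = v \<bullet> (M *v w)" and "b = w \<bullet> (M *v w)"
  have b: "b \<ge> 0"
    using nonneg w by (simp add: b_def)
  \<comment> \<open>The denominator \<open>b + 1\<close> is positive even when \<open>b = 0\<close>;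
    after clearing it the form becomes \<open>- a\<^sup>2 * (b + 2)\<close>.\<close>
  define t where "t = - a / (b + 1)"
  have "v + t *\<^sub>R w \<in> V"
    using V v w by (intro subspace_add subspace_scale)
  then have "0 \<le> (v + t *\<^sub>R w) \<bullet> (M *v (v + t *\<^sub>R w))"
    by (rule nonneg)
  also have "\<dots> = 2 * t * a + t\<^sup>2 * b"
    using v(2) inner_symmetric_matrix[OF sym, of w v]
    by (simp add: a_def b_def matrix_vector_right_distrib matrix_vector_mult_scaleR inner_add
        power2_eq_square algebra_simps)
  finally have "0 \<le> (2 * t * a + t\<^sup>2 * b) * (b + 1)\<^sup>2"
    by simp
  also have "\<dots> = 2 * (t * (b + 1)) * a * (b + 1) + (t * (b + 1))\<^sup>2 * b"
    by (simp add: power2_eq_square algebra_simps)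
  also have "t * (b + 1) = - a"
    using b by (simp add: t_def)
  also have "2 * (- a) * a * (b + 1) + (- a)\<^sup>2 * b = - a\<^sup>2 * (b + 2)"
    by (simp add: power2_eq_square algebra_simps)
  finally have "a\<^sup>2 * (b + 2) \<le> 0" by simp
  then have "a = 0"
    using b by (simp add: mult_le_0_iff)
  then show ?thesis by (simp add: a_def)
qed

lemma pos_def_matricesD:
  assumes "P \<in> pos_def_matrices"
  shows "transpose P = P" "x \<noteq> 0 \<Longrightarrow> 0 < x \<bullet> (P *v x)" "0 \<le> x \<bullet> (P *v x)"
  using assms unfolding pos_def_matrices_def by (auto, cases "x = 0", auto intro: less_imp_le)

text \<open>The vector \<open>v\<close> is a maximizer of the quotient of the two quadratic forms on \<open>V\<close>.\<close>

lemma generalized_eigenvector_exists: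
  fixes A B :: "real^'n::finite^'n"
  assumes A: "A \<in> pos_def_matrices" and B: "transpose B = B"
    and V: "subspace V" "V \<noteq> {0}"
  shows "\<exists>v\<in>V. v \<bullet> (A *v v) = 1 \<and> (\<forall>w\<in>V. v \<bullet> (A *v w) = 0 \<longrightarrow> v \<bullet> (B *v w) = 0)"
proof -
  let ?a = "\<lambda>x. x \<bullet> (A *v x)" and ?b = "\<lambda>x. x \<bullet> (B *v x)"
  let ?C = "sphere 0 1 \<inter> V"
  have cont: "continuous_on T (\<lambda>x. x \<bullet> (M *v x))" for M :: "real^'n^'n" and T
    by (intro continuous_intros linear_continuous_on linear_conv_bounded_linear[THEN iffD1] matrix_vector_mul_linear)
  have "0 \<in> V" using V(1) by (rule subspace_0)
  with V(2) obtain x where "x \<in> V" "x \<noteq> 0" by auto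
  then have "x /\<^sub>R norm x \<in> ?C"
    using V(1) by (simp add: subspace_scale)
  moreover have "compact ?C"
    using closed_subspace[OF V(1)] by (intro compact_Int_closed) auto
  moreover have "continuous_on ?C (\<lambda>x. ?b x / ?a x)"
    using pos_def_matricesD(2)[OF A]
    by (intro continuous_on_divide cont) (metis IntE dist_0_norm less_irrefl mem_sphere norm_zero zero_neq_one)
  ultimately obtain u where u: "u \<in> ?C" "\<And>y. y \<in> ?C \<Longrightarrow> ?b y / ?a y \<le> ?b u / ?a u"
    using continuous_attains_sup[of ?C "\<lambda>x. ?b x / ?a x"] by blast
  define l where "l = ?b u / ?a u"
  have "u \<noteq> 0" using u(1) by auto
  then have au: "?a u > 0" by (rule pos_def_matricesD(2)[OF A])
  \<comment> \<open>By homogeneity, maximality of \<open>l\<close> on the unit sphere makes this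
    form nonnegative on all of \<open>V\<close>, and \<open>u\<close> is a null vector of
    it.\<close>
  let ?M = "l *\<^sub>R A - B"
  have M: "x \<bullet> (?M *v y) = l * (x \<bullet> (A *v y)) - x \<bullet> (B *v y)" for x y
    by (simp add: matrix_vector_mult_diff_rdistrib scaleR_matrix_vector_assoc[symmetric] inner_diff_right)
  have "transpose ?M = ?M"
    using pos_def_matricesD(1)[OF A] B by (simp add: transpose_def vec_eq_iff)
  moreover have "0 \<le> w \<bullet> (?M *v w)" if "w \<in> V" for w
  proof (cases "w = 0")
    case False
    have aw: "?a w > 0" using False by (rule pos_def_matricesD(2)[OF A])
    have "w /\<^sub>R norm w \<in> ?C"
      using False V(1) that by (simp add: subspace_scale)
    from u(2)[OF this] have "?b w / ?a w \<le> l"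
      using False by (simp add: l_def matrix_vector_mult_scaleR)
    then have "?b w \<le> l * ?a w"
      using aw by (simp add: pos_divide_le_eq)
    then show ?thesis by (simp add: M)
  qed simp
  moreover have "u \<bullet> (?M *v u) = 0"
    unfolding M using au by (simp add: l_def)
  ultimately have *: "u \<bullet> (?M *v w) = 0" if "w \<in> V" for w
    using semidefinite_null_vector[of ?M V u w] V(1) u(1) that by blast
  define v where "v = u /\<^sub>R sqrt (?a u)"
  show ?thesis
  proof (intro bexI conjI ballI impI)
    show "v \<in> V"
      using u(1) V(1) by (simp add: v_def subspace_scale)
    show "v \<bullet> (A *v v) = 1"
      using au by (simp add: v_def matrix_vector_mult_scaleR field_simps)
    show "v \<bullet> (B *v w) = 0" if "w \<in> V" "v \<bullet> (A *v w) = 0" for w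
      using *[OF that(1)] that(2) au by (simp add: v_def M)
  qed
qed

text \<open>Each new vector is a generalized eigenvector in the \<open>A\<close>-orthogonal
  complement of the earlier ones. The third clause says that this complement is also
  \<open>B\<close>-orthogonal to them, which carries the second clause through the
  induction.\<close>

lemma simultaneous_orthogonalization:
  fixes A B :: "real^'n::finite^'n"
  assumes A: "A \<in> pos_def_matrices" and B: "transpose B = B" and "finite (I :: 'n set)"
  shows "\<exists>s. (\<forall>i\<in>I. \<forall>j\<in>I. s i \<bullet> (A *v s j) = of_bool (i = j)) \<and>
             (\<forall>i\<in>I. \<forall>j\<in>I. i \<noteq> j \<longrightarrow> s i \<bullet> (B *v s j) = 0) \<and>
             (\<forall>i\<in>I. \<forall>w. (\<forall>j\<in>I. s j \<bullet> (A *v w) = 0) \<longrightarrow> s i \<bullet> (B *v w) = 0)"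
  using assms(3)
proof (induction I)
  case (insert k I)
  from insert.IH obtain s where s: "\<forall>i\<in>I. \<forall>j\<in>I. s i \<bullet> (A *v s j) = of_bool (i = j)"
    "\<forall>i\<in>I. \<forall>j\<in>I. i \<noteq> j \<longrightarrow> s i \<bullet> (B *v s j) = 0"
    "\<forall>i\<in>I. \<forall>w. (\<forall>j\<in>I. s j \<bullet> (A *v w) = 0) \<longrightarrow> s i \<bullet> (B *v w) = 0"
    by (elim exE conjE) (rule that)
  define V where "V = {w. \<forall>j\<in>I. s j \<bullet> (A *v w) = 0}"
  note sym = inner_symmetric_matrix[OF pos_def_matricesD(1)[OF A]] inner_symmetric_matrix[OF B]
  have "subspace V"
    by (auto simp: V_def subspace_def matrix_vector_right_distrib matrix_vector_mult_scaleR inner_add_right)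
  \<comment> \<open>Fewer than \<open>CARD('n)\<close> vectors \<open>A *v s j\<close> cannot span
    the space, so some nonzero vector is orthogonal to all of them.\<close>
  moreover have "V \<noteq> {0}"
  proof -
    have "dim ((\<lambda>j. A *v s j) ` I) \<le> card ((\<lambda>j. A *v s j) ` I)"
      using insert(1) by (simp add: dim_le_card')
    also have "\<dots> \<le> card I"
      using insert(1) by (rule card_image_le)
    also have "\<dots> < CARD('n)"
      using insert(2) by (intro psubset_card_mono) auto
    finally obtain x where x: "x \<noteq> 0" "\<And>y. y \<in> span ((\<lambda>j. A *v s j) ` I) \<Longrightarrow> orthogonal x y"
      using orthogonal_to_subspace_exists[of "(\<lambda>j. A *v s j) ` I"] by (metis DIM_cart DIM_real mult.right_neutral)
    have "x \<in> V"
      using x(2)[OF span_base] sym(1)[of _ x] by (simp add: V_def orthogonal_def)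
    with x(1) show ?thesis by blast
  qed
  ultimately obtain v where v: "v \<in> V" "v \<bullet> (A *v v) = 1"
    "\<And>w. w \<in> V \<Longrightarrow> v \<bullet> (A *v w) = 0 \<Longrightarrow> v \<bullet> (B *v w) = 0"
    using generalized_eigenvector_exists[OF A B] by blast
  define s' where "s' = s(k := v)"
  have s': "s' k = v" "\<And>i. i \<in> I \<Longrightarrow> s' i = s i"
    using insert(2) by (auto simp: s'_def)
  have sv: "s i \<bullet> (A *v v) = 0" "s i \<bullet> (B *v v) = 0" if "i \<in> I" for i
    using v(1) s(3) that by (simp_all add: V_def)
  then have vs: "v \<bullet> (A *v s i) = 0" "v \<bullet> (B *v s i) = 0" if "i \<in> I" for i
    using that sym(1)[of v "s i"] sym(2)[of v "s i"] by simp_all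
  have "\<forall>i\<in>insert k I. \<forall>w. (\<forall>j\<in>insert k I. s' j \<bullet> (A *v w) = 0) \<longrightarrow> s' i \<bullet> (B *v w) = 0"
    using s(3) v(3) by (simp add: s' V_def)
  moreover have "\<forall>i\<in>insert k I. \<forall>j\<in>insert k I. s' i \<bullet> (A *v s' j) = of_bool (i = j)"
  proof (intro ballI)
    fix i j assume "i \<in> insert k I" "j \<in> insert k I"
    then show "s' i \<bullet> (A *v s' j) = of_bool (i = j)"
      using s(1) sv(1) vs(1) v(2) insert(2) s' by (cases "i = k"; cases "j = k") auto
  qed
  moreover have "\<forall>i\<in>insert k I. \<forall>j\<in>insert k I. i \<noteq> j \<longrightarrow> s' i \<bullet> (B *v s' j) = 0"
    using s(2) sv vs by (simp add: s')
  ultimately show ?case by (intro exI[of _ s'] conjI)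
qed simp

lemma congruence_component:
  fixes S M :: "real^'n::finite^'n"
  shows "(transpose S ** M ** S) $ i $ j = column i S \<bullet> (M *v column j S)"
proof -
  have "column i S \<bullet> (M *v column j S) = axis i 1 \<bullet> (transpose S *v (M *v (S *v axis j 1)))"
    by (metis dot_lmul_matrix inner_commute matrix_vector_mult_basis transpose_matrix_vector)
  also have "\<dots> = axis i 1 \<bullet> ((transpose S ** M ** S) *v axis j 1)"
    by (simp only: matrix_vector_mul_assoc matrix_mul_assoc)
  finally show ?thesis
    by (simp add: inner_axis' matrix_vector_mult_basis column_def)
qed

text \<open>The orthogonalized vectors become the columns of \<open>S\<close>. The last clause turns
  determinant comparisons into comparisons of diagonal products; with \<open>M = A\<close> it also
  yields \<open>det S \<noteq> 0\<close>.\<close>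

lemma simultaneous_diagonalization:
  fixes A B :: "real^'n::finite^'n"
  assumes A: "A \<in> pos_def_matrices" and B: "transpose B = B"
  obtains S d where "transpose S ** A ** S = mat 1"
    "transpose S ** B ** S = (\<chi> i j. if i = j then d i else 0)"
    "\<And>i. d i = column i S \<bullet> (B *v column i S)"
    "\<And>i. column i S \<noteq> 0"
    "\<And>M. (det S)\<^sup>2 * det M = det (transpose S ** M ** S)"
proof -
  obtain s :: "'n \<Rightarrow> real^'n" where
    "\<forall>i\<in>UNIV. \<forall>j\<in>UNIV. s i \<bullet> (A *v s j) = of_bool (i = j)"
    "\<forall>i\<in>UNIV. \<forall>j\<in>UNIV. i \<noteq> j \<longrightarrow> s i \<bullet> (B *v s j) = 0"
    using simultaneous_orthogonalization[OF A B finite, of UNIV] by (elim exE conjE) (rule that)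
  then have s: "s i \<bullet> (A *v s j) = of_bool (i = j)" "i \<noteq> j \<Longrightarrow> s i \<bullet> (B *v s j) = 0" for i j
    by simp_all
  define S where "S = (\<chi> i j. s j $ i)"
  have col: "column j S = s j" for j
    by (simp add: S_def column_def vec_eq_iff)
  show ?thesis
  proof
    show "transpose S ** A ** S = mat 1"
      by (simp add: vec_eq_iff congruence_component col s(1) mat_def)
    show "transpose S ** B ** S = (\<chi> i j. if i = j then column i S \<bullet> (B *v column i S) else 0)"
      by (simp add: vec_eq_iff congruence_component col s(2))
    show "column i S \<noteq> 0" for i
      using s(1)[of i i] by (metis col inner_zero_left of_bool_eq(2) zero_neq_one)
    show "(det S)\<^sup>2 * det M = det (transpose S ** M ** S)" for M
      by (simp add: det_mul power2_eq_square)
  qed simp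
qed

subsection \<open>Determinants of positive definite matrices\<close>

text \<open>Diagonalizing \<open>P\<close> against itself gives
  \<open>(det S)\<^sup>2 * det P = 1\<close>.\<close>

lemma det_pos_def:
  fixes P :: "real^'n::finite^'n"
  assumes P: "P \<in> pos_def_matrices"
  shows "0 < det P"
proof -
  obtain S where S: "transpose S ** P ** S = mat 1" "\<And>M. (det S)\<^sup>2 * det M = det (transpose S ** M ** S)"
    using simultaneous_diagonalization[OF P pos_def_matricesD(1)[OF P]] by metis
  have "(det S)\<^sup>2 * det P = 1"
    by (simp only: S det_I)
  then show ?thesis
    by (metis zero_le_power2 zero_less_mult_pos zero_less_one mult_zero_left order_le_less zero_neq_one)
qed

lemma congruence_inject:
  fixes S M N :: "real^'n::finite^'n"
  assumes "det S \<noteq> 0" "transpose S ** M ** S = transpose S ** N ** S"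
  shows "M = N"
proof -
  obtain T where T: "S ** T = mat 1"
    using assms(1) invertible_det_nz[of S] unfolding invertible_def by blast
  then have T': "transpose T ** transpose S = mat 1"
    by (metis matrix_transpose_mul transpose_mat)
  have *: "transpose T ** (transpose S ** X ** S) ** T = X" for X
    by (simp add: matrix_mul_assoc[symmetric] T) (simp add: matrix_mul_assoc T')
  show ?thesis
    by (subst *[of M, symmetric], subst assms(2), rule *)
qed

lemma matrix_add_congruence:
  fixes S M N :: "real^'n::finite^'n"
  shows "transpose S ** (M + N) ** S = transpose S ** M ** S + transpose S ** N ** S"
proof -
  have "(X + Y) ** S = X ** S + Y ** S" for X Y :: "real^'n^'n"
    by (simp add: vec_eq_iff matrix_matrix_mult_def sum.distrib distrib_right)
  then show ?thesis
    by (simp only: matrix_add_ldistrib)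
qed

text \<open>After diagonalization \<open>A\<close> is the identity and \<open>B\<close> has
  nonnegative entries \<open>d i\<close>, not all zero, so the determinant grows by the factor
  \<open>\<Prod>i. 1 + d i\<close>, which exceeds 1.\<close>

lemma det_add_semidefinite:
  fixes A B :: "real^'n::finite^'n"
  assumes A: "A \<in> pos_def_matrices" and B: "transpose B = B" "\<And>x. 0 \<le> x \<bullet> (B *v x)" "B \<noteq> 0"
  shows "det A < det (A + B)"
proof -
  obtain S d where S: "transpose S ** A ** S = mat 1"
    "transpose S ** B ** S = (\<chi> i j. if i = j then d i else 0)"
    "\<And>i. d i = column i S \<bullet> (B *v column i S)" "\<And>i. column i S \<noteq> 0"
    "\<And>M. (det S)\<^sup>2 * det M = det (transpose S ** M ** S)"
    by (rule simultaneous_diagonalization[OF A B(1)]) (rule that)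
  have one: "(det S)\<^sup>2 * det A = 1"
    by (simp only: S det_I)
  then have "det S \<noteq> 0" by auto
  have nonneg: "0 \<le> d i" for i
    by (simp only: S(3) B(2))
  have "\<exists>k. d k \<noteq> 0"
  proof (rule ccontr)
    assume "\<nexists>k. d k \<noteq> 0"
    then have "transpose S ** B ** S = transpose S ** 0 ** S"
      by (simp add: S(2) vec_eq_iff congruence_component)
    with \<open>B \<noteq> 0\<close> congruence_inject[OF \<open>det S \<noteq> 0\<close>] show False by blast
  qed
  then obtain k where "d k \<noteq> 0" ..
  have "transpose S ** (A + B) ** S = (\<chi> i j. if i = j then 1 + d i else 0)"
    by (simp add: matrix_add_congruence S(1,2) vec_eq_iff mat_def)
  then have "(det S)\<^sup>2 * det (A + B) = (\<Prod>i\<in>UNIV. 1 + d i)"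
    by (simp add: S(5) det_diagonal)
  also have "\<dots> > 1"
    using nonneg \<open>d k \<noteq> 0\<close> by (intro less_1_prod2[of _ k]) (auto simp: order_less_le)
  finally have "(det S)\<^sup>2 * det A < (det S)\<^sup>2 * det (A + B)"
    by (simp only: one)
  then show ?thesis
    by (simp add: mult_less_cancel_left_pos \<open>det S \<noteq> 0\<close>)
qed

text \<open>After diagonalization equal determinants mean that the product of the \<open>d i\<close>
  is 1, while the midpoint has diagonal entries \<open>(1 + d i) / 2\<close>. Some
  \<open>d i\<close> differs from 1, so the inequality of the means is strict.\<close>

lemma det_midpoint_strict:
  fixes A B :: "real^'n::finite^'n"
  assumes A: "A \<in> pos_def_matrices" and B: "B \<in> pos_def_matrices"
    and eq: "det A = det B" and ne: "A \<noteq> B"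
  shows "det A < det ((1/2) *\<^sub>R (A + B))"
proof -
  obtain S d where S: "transpose S ** A ** S = mat 1"
    "transpose S ** B ** S = (\<chi> i j. if i = j then d i else 0)"
    "\<And>i. d i = column i S \<bullet> (B *v column i S)" "\<And>i. column i S \<noteq> 0"
    "\<And>M. (det S)\<^sup>2 * det M = det (transpose S ** M ** S)"
    by (rule simultaneous_diagonalization[OF A pos_def_matricesD(1)[OF B]]) (rule that)
  have one: "(det S)\<^sup>2 * det A = 1"
    by (simp only: S det_I)
  then have "det S \<noteq> 0" by auto
  have pos: "0 < d i" for i
    unfolding S(3) by (rule pos_def_matricesD(2)[OF B S(4)])
  have "\<exists>k. d k \<noteq> 1"
  proof (rule ccontr)
    assume "\<nexists>k. d k \<noteq> 1"
    then have "transpose S ** A ** S = transpose S ** B ** S"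
      by (simp add: S(1,2) vec_eq_iff mat_def)
    with ne congruence_inject[OF \<open>det S \<noteq> 0\<close>] show False by blast
  qed
  then obtain k where k: "d k \<noteq> 1" ..
  have "1 = (det S)\<^sup>2 * det B"
    by (simp only: one eq[symmetric])
  also have "\<dots> = (\<Prod>i\<in>UNIV. d i)"
    by (simp add: S(2,5) det_diagonal)
  finally have prod_d: "(\<Prod>i\<in>UNIV. d i) = 1" by simp
  define m where "m = (\<Prod>i\<in>UNIV. (1 + d i) / 2)"
  \<comment> \<open>Squaring avoids roots, and dividing by \<open>d i\<close> does not change the
    full product because the \<open>d i\<close> multiply to 1.\<close>
  have amgm: "((1 + x) / 2)\<^sup>2 / x = 1 + ((1 - x) / 2)\<^sup>2 / x" if "x > 0" for x :: real
    using that by (simp add: field_simps power2_eq_square)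
  have "1 < (\<Prod>i\<in>UNIV. ((1 + d i) / 2)\<^sup>2 / d i)"
    using pos k by (intro less_1_prod2[of _ k]) (auto simp: amgm less_imp_le)
  also have "\<dots> = m\<^sup>2"
    by (simp only: prod_dividef prod_d prod_power_distrib[symmetric] m_def div_by_1)
  finally have "1 < m\<^sup>2" .
  moreover have "0 \<le> m"
    unfolding m_def using pos by (intro prod_nonneg) (simp add: add_nonneg_nonneg less_imp_le)
  ultimately have "1 < m"
    using power2_le_imp_le[of m 1] by (metis linorder_not_less one_power2 power_mono)
  have "transpose S ** ((1/2) *\<^sub>R (A + B)) ** S = (1/2) *\<^sub>R (transpose S ** (A + B) ** S)"
    by (simp add: vec_eq_iff congruence_component scaleR_matrix_vector_assoc[symmetric])
  also have "\<dots> = (\<chi> i j. if i = j then (1 + d i) / 2 else 0)"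
    by (simp add: matrix_add_congruence S(1,2) vec_eq_iff mat_def)
  finally have "(det S)\<^sup>2 * det ((1/2) *\<^sub>R (A + B)) = m"
    by (simp add: S(5) det_diagonal m_def)
  with \<open>1 < m\<close> have "(det S)\<^sup>2 * det A < (det S)\<^sup>2 * det ((1/2) *\<^sub>R (A + B))"
    by (simp only: one)
  then show ?thesis
    by (simp add: mult_less_cancel_left_pos \<open>det S \<noteq> 0\<close>)
qed

section \<open>Scaling of the determinant and continuity of matrix operations\<close>

lemma det_scaleR:
  fixes A :: "real^'n::finite^'n"
  shows "det (c *\<^sub>R A) = c ^ CARD('n) * det A"
proof -
  have "c *\<^sub>R A = (\<chi> i. c *s A $ i)"
    by (simp add: vec_eq_iff)
  then show ?thesis
    using det_rows_mul[of "\<lambda>_. c" "\<lambda>i. A $ i"] by simp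
qed

lemma tendsto_matrix_vector_mult [tendsto_intros]:
  fixes A :: "real^'n::finite^'m::finite"
  assumes "(f \<longlongrightarrow> A) F" "(g \<longlongrightarrow> x) F"
  shows "((\<lambda>k. f k *v g k) \<longlongrightarrow> A *v x) F"
  unfolding matrix_vector_mult_def
  by (intro tendsto_vec_lambda tendsto_sum tendsto_mult tendsto_vec_nth assms)

lemma tendsto_det [tendsto_intros]:
  fixes A :: "real^'n::finite^'n"
  assumes "(f \<longlongrightarrow> A) F"
  shows "((\<lambda>k. det (f k)) \<longlongrightarrow> det A) F"
  unfolding det_def
  by (intro tendsto_sum tendsto_mult tendsto_prod tendsto_vec_nth tendsto_const assms)

lemma tendsto_transpose [tendsto_intros]:
  fixes A :: "real^'n::finite^'m::finite"
  assumes "(f \<longlongrightarrow> A) F"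
  shows "((\<lambda>k. transpose (f k)) \<longlongrightarrow> transpose A) F"
  unfolding transpose_def by (intro tendsto_vec_lambda tendsto_vec_nth assms)

subsection \<open>Existence and uniqueness\<close>

text \<open>Unlike \<open>pos_def_matrices\<close>, this cone is closed. Maximizers and limits are
  found here first and then shown to be definite by their nonzero determinant.\<close>

definition semidefinite_matrices :: "(real^'n^'n) set" where
  "semidefinite_matrices = {P. transpose P = P \<and> (\<forall>x. 0 \<le> x \<bullet> (P *v x))}"

lemma pos_def_imp_semidefinite: "P \<in> pos_def_matrices \<Longrightarrow> P \<in> semidefinite_matrices"
  by (simp add: semidefinite_matrices_def pos_def_matricesD)

text \<open>A nonzero \<open>x\<close> on which the form vanishes would satisfy
  \<open>P *v x = 0\<close> by \<open>semidefinite_null_vector\<close>, against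
  invertibility.\<close>

lemma semidefinite_imp_pos_def:
  fixes P :: "real^'n::finite^'n"
  assumes P: "P \<in> semidefinite_matrices" and det: "det P \<noteq> 0"
  shows "P \<in> pos_def_matrices"
proof -
  have sym: "transpose P = P" and nonneg: "0 \<le> x \<bullet> (P *v x)" for x
    using P by (simp_all add: semidefinite_matrices_def)
  have "x \<bullet> (P *v x) \<noteq> 0" if "x \<noteq> 0" for x
  proof
    assume "x \<bullet> (P *v x) = 0"
    then have "x \<bullet> (P *v w) = 0" for w
      using semidefinite_null_vector[OF sym subspace_UNIV] nonneg by blast
    then have "(P *v x) \<bullet> (P *v x) = 0"
      by (metis inner_symmetric_matrix[OF sym])
    then have "P *v x = P *v 0" by simp
    moreover have "inj ((*v) P)"
      using det by (metis invertible_det_nz invertible_eq_bij bij_is_inj)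
    ultimately show False
      using \<open>x \<noteq> 0\<close> by (metis injD)
  qed
  then show ?thesis
    using sym nonneg by (auto simp: pos_def_matrices_def order_less_le)
qed

lemma pos_def_add_semidefinite:
  assumes "A \<in> pos_def_matrices" "B \<in> semidefinite_matrices"
  shows "A + B \<in> pos_def_matrices"
proof -
  have "transpose (A + B) = transpose A + transpose B"
    by (simp add: transpose_def vec_eq_iff)
  then show ?thesis
    using assms by (simp add: pos_def_matrices_def semidefinite_matrices_def
        matrix_vector_mult_add_rdistrib inner_add_right add_pos_nonneg)
qed

lemma pos_def_scaleR:
  assumes "A \<in> pos_def_matrices" "c > 0"
  shows "c *\<^sub>R A \<in> pos_def_matrices"
  using assms by (simp add: pos_def_matrices_def transpose_scalar scaleR_matrix_vector_assoc[symmetric])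

lemma pos_def_mat_1: "mat 1 \<in> pos_def_matrices"
  by (simp add: pos_def_matrices_def)

text \<open>This is the rank-one perturbation used to prove uniqueness of the translation.\<close>

lemma outer_product_mult:
  fixes u x :: "real^'n::finite"
  shows "(\<chi> i j. u $ i * u $ j) *v x = (u \<bullet> x) *\<^sub>R u"
  by (simp add: vec_eq_iff matrix_vector_mult_def inner_vec_def sum_distrib_left mult_ac)

section \<open>Limits and uniform bounds of positive images\<close>

lemma convex_body_approx:
  assumes "dist K L < e" "x \<in> body K"
  shows "\<exists>y\<in>body L. dist x y < e"
proof -
  obtain d where d: "d < e" "d \<in> hausdorff_admissible (body K) (body L)"
    using hausdorff_dist_less[of "body K" "body L" e] assms(1)
      compact_imp_bounded[OF compact_body] body_nonempty
    unfolding dist_convex_body_def by blast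
  show ?thesis
    using hausdorff_admissibleD(3)[OF d(2) assms(2)] d(1) by force
qed

text \<open>A point of \<open>L\<close> is approximated in \<open>Ls k\<close>, mapped into
  \<open>Ks k\<close>, and approximated again in \<open>K\<close>; the resulting points of
  \<open>K\<close> converge to the image, and \<open>K\<close> is closed.\<close>

lemma affine_image_subset_limit:
  fixes K L :: "'n::finite convex_body"
  assumes lim: "Ks \<longlonglongrightarrow> K" "Ls \<longlonglongrightarrow> L" "Ps \<longlonglongrightarrow> P" "zs \<longlonglongrightarrow> z"
    and sub: "\<And>k. affine_image (Ps k) (zs k) (body (Ls k)) \<subseteq> body (Ks k)"
  shows "affine_image P z (body L) \<subseteq> body K"
proof -
  have "P *v x + z \<in> body K" if x: "x \<in> body L" for x
  proof -
    \<comment> \<open>The positive last summand makes both distance bounds strict, as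
      \<open>convex_body_approx\<close> requires.\<close>
    define e where "e k = dist (Ks k) K + dist (Ls k) L + inverse (real (Suc k))" for k
    have "e \<longlonglongrightarrow> 0 + 0 + 0"
      unfolding e_def using lim(1,2)
      by (intro tendsto_add LIMSEQ_inverse_real_of_nat) (simp_all add: tendsto_dist_iff[symmetric])
    then have e: "e \<longlonglongrightarrow> 0" by simp
    have less: "dist (Ks k) K < e k" "dist L (Ls k) < e k" for k
      by (simp_all add: e_def dist_commute[of L] add_nonneg_pos add_pos_nonneg add.assoc)
    have "\<exists>xs. \<forall>k. xs k \<in> body (Ls k) \<and> dist x (xs k) < e k"
      using convex_body_approx[OF less(2) x] by metis
    then obtain xs where xs: "\<And>k. xs k \<in> body (Ls k)" "\<And>k. dist x (xs k) < e k" by blast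
    define us where "us k = Ps k *v xs k + zs k" for k
    have "\<And>k. us k \<in> body (Ks k)"
      using sub xs(1) by (auto simp: affine_image_def us_def)
    then have "\<forall>k. \<exists>y. y \<in> body K \<and> dist (us k) y < e k"
      using convex_body_approx[OF less(1)] by blast
    from choice[OF this] obtain ys where ys: "\<And>k. ys k \<in> body K" "\<And>k. dist (us k) (ys k) < e k" by blast
    have "(\<lambda>k. dist (xs k) x) \<longlonglongrightarrow> 0"
      using xs(2) by (intro tendsto_sandwich[OF _ _ tendsto_const e] always_eventually)
        (auto simp: dist_commute less_imp_le)
    then have "xs \<longlonglongrightarrow> x"
      by (rule tendsto_dist_iff[THEN iffD2])
    then have us: "us \<longlonglongrightarrow> P *v x + z"
      unfolding us_def by (intro tendsto_intros lim)
    have "(\<lambda>k. dist (us k) (ys k)) \<longlonglongrightarrow> 0"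
      using ys(2) by (intro tendsto_sandwich[OF _ _ tendsto_const e] always_eventually)
        (auto simp: less_imp_le)
    then have "(\<lambda>k. us k - ys k) \<longlonglongrightarrow> 0"
      unfolding dist_norm by (rule tendsto_norm_zero_cancel)
    with us have "ys \<longlonglongrightarrow> P *v x + z"
      by (rule Lim_transform2)
    then show ?thesis
      using ys(1) compact_imp_closed[OF compact_body[of K]] closed_sequentially by blast
  qed
  then show ?thesis
    by (auto simp: affine_image_def)
qed

lemma semidefinite_limit:
  assumes "Ps \<longlonglongrightarrow> P" "\<And>k. Ps k \<in> semidefinite_matrices"
  shows "P \<in> semidefinite_matrices"
proof -
  have "(\<lambda>k. transpose (Ps k)) \<longlonglongrightarrow> P"
    using assms by (simp add: semidefinite_matrices_def)
  then have "transpose P = P"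
    using tendsto_transpose[OF assms(1)] LIMSEQ_unique by blast
  moreover have "0 \<le> x \<bullet> (P *v x)" for x
  proof (rule LIMSEQ_le_const)
    show "(\<lambda>k. x \<bullet> (Ps k *v x)) \<longlonglongrightarrow> x \<bullet> (P *v x)"
      by (intro tendsto_intros assms(1))
  qed (use assms(2) in \<open>auto simp: semidefinite_matrices_def\<close>)
  ultimately show ?thesis
    by (simp add: semidefinite_matrices_def)
qed

text \<open>For \<open>norm v = r\<close>, \<open>P *v v\<close> is a difference of two image
  points, hence of norm at most \<open>2 * R\<close>. This bounds the entries of \<open>P\<close>,
  and then \<open>z\<close>. The bound depends only on the two balls, so it serves whole sequences
  of bodies.\<close>

lemma affine_image_norm_bound:
  fixes c :: "real^'n::finite"
  assumes "r > 0"
  shows "\<exists>M. \<forall>P z L. cball c r \<subseteq> L \<longrightarrow> affine_image P z L \<subseteq> cball 0 R \<longrightarrow> norm (P, z) \<le> M"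
proof (intro exI allI impI)
  fix P :: "real^'n^'n" and z :: "real^'n" and L
  assume L: "cball c r \<subseteq> L" "affine_image P z L \<subseteq> cball 0 R"
  define b where "b = 2 * R / r"
  have bound: "norm (P *v x + z) \<le> R" if "x \<in> cball c r" for x
  proof -
    have "P *v x + z \<in> cball 0 R"
      using L that unfolding affine_image_def by blast
    then show ?thesis by simp
  qed
  have Pw: "norm (P *v w) \<le> b * norm w" for w
  proof (cases "w = 0")
    case False
    define v where "v = (r / norm w) *\<^sub>R w"
    have "norm v = r"
      using False assms by (simp add: v_def)
    then have "norm (P *v (c + v) + z) \<le> R" "norm (P *v c + z) \<le> R"
      using assms by (auto intro!: bound simp: dist_norm)
    then have "norm (P *v v) \<le> 2 * R"
      using norm_triangle_ineq4[of "P *v (c + v) + z" "P *v c + z"]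
      by (simp add: matrix_vector_right_distrib)
    then show ?thesis
      using False assms by (simp add: v_def b_def matrix_vector_mult_scaleR field_simps)
  qed simp
  have "\<bar>P $ i $ j\<bar> \<le> b" for i j
  proof -
    have "\<bar>P $ i $ j\<bar> = \<bar>(P *v axis j 1) $ i\<bar>"
      by (simp add: matrix_vector_mult_basis column_def)
    also have "\<dots> \<le> norm (P *v axis j 1)"
      by (rule component_le_norm_cart)
    also have "\<dots> \<le> b"
      using Pw[of "axis j 1"] by simp
    finally show ?thesis .
  qed
  then have "(\<Sum>j\<in>UNIV. \<bar>P $ i $ j\<bar>) \<le> CARD('n) * b" for i
    by (rule sum_bounded_above)
  then have "norm (P $ i) \<le> CARD('n) * b" for i
    using norm_le_l1_cart[of "P $ i"] order_trans by blast
  then have "(\<Sum>i\<in>UNIV. norm (P $ i)) \<le> CARD('n) * (CARD('n) * b)"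
    by (rule sum_bounded_above)
  then have "norm P \<le> CARD('n) * (CARD('n) * b)"
    unfolding norm_vec_def using L2_set_le_sum[of UNIV "\<lambda>i. norm (P $ i)"] by (simp add: norm_vec_def)
  moreover have "norm z \<le> R + b * norm c"
    using bound[of c] assms Pw[of c] norm_triangle_ineq4[of "P *v c + z" "P *v c"] by simp
  ultimately show "norm (P, z) \<le> CARD('n) * (CARD('n) * b) + (R + b * norm c)"
    using norm_Pair_le[of P z] by linarith
qed

lemma body_contains_cball:
  obtains c r where "r > 0" "cball c r \<subseteq> body K"
  using interior_body[of K] by (metis ex_in_conv mem_interior_cball)

lemma body_subset_cball:
  obtains R where "R > 0" "body K \<subseteq> cball 0 R"
  using compact_imp_bounded[OF compact_body[of K]] by (auto simp: bounded_pos subset_iff)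

lemma body_lmeasurable: "body K \<in> lmeasurable"
  by (rule lmeasurable_compact[OF compact_body])

lemma body_measure_pos: "0 < measure lebesgue (body K)"
proof -
  obtain c r where "r > 0" "cball c r \<subseteq> body K"
    by (rule body_contains_cball)
  then have "measure lebesgue (cball c r) \<le> measure lebesgue (body K)"
    by (intro measure_mono_fmeasurable) (auto simp: body_lmeasurable)
  moreover have "0 < measure lebesgue (cball c r)"
    using \<open>r > 0\<close> by (simp add: content_cball_pos)
  ultimately show ?thesis by linarith
qed

text \<open>Volumes of positive images of \<open>L\<close> are determinants times the positive
  volume of \<open>L\<close>, which cancels.\<close>

lemma realizes_iff_det_maximal:
  fixes K L :: "'n::finite convex_body"
  shows "realizes_positive_John_image K L (P, z) \<longleftrightarrow>
    P \<in> pos_def_matrices \<and> affine_image P z (body L) \<subseteq> body K \<and>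
    (\<forall>Q w. Q \<in> pos_def_matrices \<longrightarrow> affine_image Q w (body L) \<subseteq> body K \<longrightarrow> det Q \<le> det P)"
proof -
  have m: "measure lebesgue (affine_image Q w (body L)) = det Q * measure lebesgue (body L)"
    if "Q \<in> pos_def_matrices" for Q :: "real^'n^'n" and w
    using measure_affine_image[OF body_lmeasurable, of Q w L] det_pos_def[OF that] by simp
  have le: "measure lebesgue (affine_image Q w (body L)) \<le> measure lebesgue (affine_image P z (body L))
      \<longleftrightarrow> det Q \<le> det P" if "Q \<in> pos_def_matrices" "P \<in> pos_def_matrices" for Q w
    using body_measure_pos[of L] by (simp add: m that)
  have all: "(\<forall>E\<in>positive_images (body K) (body L). \<phi> E) \<longleftrightarrow>
      (\<forall>Q w. Q \<in> pos_def_matrices \<longrightarrow> affine_image Q w (body L) \<subseteq> body K \<longrightarrow> \<phi> (affine_image Q w (body L)))"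
    for \<phi>
    unfolding positive_images_def by blast
  show ?thesis
  proof (cases "P \<in> pos_def_matrices")
    case True
    have "affine_image P z (body L) \<in> positive_images (body K) (body L) \<longleftrightarrow> affine_image P z (body L) \<subseteq> body K"
      using True unfolding positive_images_def by auto
    then show ?thesis
      using True le unfolding realizes_positive_John_image_def is_positive_John_image_def all by auto
  qed (simp add: realizes_positive_John_image_def)
qed

lemma realizes_exists:
  fixes K L :: "'n::finite convex_body"
  shows "\<exists>P z. realizes_positive_John_image K L (P, z)"
proof -
  let ?C = "{(P, z). P \<in> semidefinite_matrices \<and> affine_image P z (body L) \<subseteq> body K}"
  obtain c r where r: "r > 0" "cball c r \<subseteq> body L"
    by (rule body_contains_cball)
  obtain R where R: "R > 0" "body K \<subseteq> cball 0 R"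
    by (rule body_subset_cball)
  obtain M where M: "\<And>P z. affine_image P z (body L) \<subseteq> body K \<Longrightarrow> norm (P, z) \<le> M"
    using affine_image_norm_bound[OF r(1), of c R] r(2) R(2) by (meson order_trans)
  have "bounded ?C"
    using M by (intro boundedI[of _ M]) auto
  moreover have "closed ?C"
    unfolding closed_sequential_limits
  proof (intro allI impI)
    fix f and p ::  "(real^'n^'n) \<times> (real^'n)"
    assume f: "(\<forall>k. f k \<in> ?C) \<and> f \<longlonglongrightarrow> p"
    have lim: "(\<lambda>k. fst (f k)) \<longlonglongrightarrow> fst p" "(\<lambda>k. snd (f k)) \<longlonglongrightarrow> snd p"
      using f by (auto intro: tendsto_fst tendsto_snd)
    have mem: "fst (f k) \<in> semidefinite_matrices" "affine_image (fst (f k)) (snd (f k)) (body L) \<subseteq> body K" for k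
      using f by (auto simp: case_prod_beta)
    show "p \<in> ?C"
      using semidefinite_limit[OF lim(1) mem(1)]
        affine_image_subset_limit[OF tendsto_const tendsto_const lim mem(2)]
      by (simp add: case_prod_beta)
  qed
  ultimately have "compact ?C"
    by (simp add: compact_eq_bounded_closed)
  \<comment> \<open>A ball around the origin containing \<open>L\<close> is scaled to the size of a
    ball in \<open>K\<close> and moved to its centre; this feasible pair forces the maximal
    determinant to be positive.\<close>
  obtain Q w where Q: "Q \<in> pos_def_matrices" "affine_image Q w (body L) \<subseteq> body K"
  proof -
    obtain c r where r: "r > 0" "cball c r \<subseteq> body K"
      by (rule body_contains_cball)
    obtain R where R: "R > 0" "body L \<subseteq> cball 0 R"
      by (rule body_subset_cball)
    show ?thesis
    proof
      show "(r / R) *\<^sub>R mat 1 \<in> pos_def_matrices"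
        using r R by (intro pos_def_scaleR pos_def_mat_1) simp
      show "affine_image ((r / R) *\<^sub>R mat 1) c (body L) \<subseteq> body K"
      proof -
        have "(r / R) *\<^sub>R x + c \<in> cball c r" if "x \<in> body L" for x
        proof -
          have "norm x \<le> R" using R(2) that by auto
          then have "r / R * norm x \<le> r"
            using r R by (simp add: field_simps)
          then show ?thesis using r R by (simp add: dist_norm)
        qed
        then show ?thesis
          using r(2) by (auto simp: affine_image_def scaleR_matrix_vector_assoc[symmetric])
      qed
    qed
  qed
  then have "(Q, w) \<in> ?C"
    by (simp add: pos_def_imp_semidefinite)
  moreover have "continuous_on ?C (\<lambda>p. det (fst p))"
    unfolding continuous_on_def by (intro ballI tendsto_intros)
  ultimately obtain p where p: "p \<in> ?C" "\<And>q. q \<in> ?C \<Longrightarrow> det (fst q) \<le> det (fst p)"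
    using continuous_attains_sup[OF \<open>compact ?C\<close>, of "\<lambda>p. det (fst p)"] by blast
  obtain P z where Pz: "p = (P, z)" by (cases p)
  have max: "det Q' \<le> det P" if "Q' \<in> pos_def_matrices" "affine_image Q' w' (body L) \<subseteq> body K" for Q' w'
    using p(2)[of "(Q', w')"] that by (simp add: Pz pos_def_imp_semidefinite)
  have "det P > 0"
    using max[OF Q] det_pos_def[OF Q(1)] by simp
  then have "P \<in> pos_def_matrices"
    using p(1) by (intro semidefinite_imp_pos_def) (auto simp: Pz)
  then have "realizes_positive_John_image K L (P, z)"
    using p(1) max by (auto simp: realizes_iff_det_maximal Pz)
  then show ?thesis by blast
qed

lemma realizes_unique:
  fixes K L :: "'n::finite convex_body"
  assumes 1: "realizes_positive_John_image K L (P, z)" and 2: "realizes_positive_John_image K L (Q, w)"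
  shows "P = Q \<and> z = w"
proof -
  have P: "P \<in> pos_def_matrices" "affine_image P z (body L) \<subseteq> body K"
    and max: "\<And>R v. R \<in> pos_def_matrices \<Longrightarrow> affine_image R v (body L) \<subseteq> body K \<Longrightarrow> det R \<le> det P"
    and Q: "Q \<in> pos_def_matrices" "affine_image Q w (body L) \<subseteq> body K"
    and max': "det P \<le> det Q"
    using 1 2 by (auto simp: realizes_iff_det_maximal)
  have mem: "P *v x + z \<in> body K" "Q *v x + w \<in> body K" if "x \<in> body L" for x
    using P(2) Q(2) that by (auto simp: affine_image_def)
  have "P = Q"
  proof (rule ccontr)
    assume "P \<noteq> Q"
    let ?M = "(1/2) *\<^sub>R (P + Q)"
    have "det P = det Q"
      using max[OF Q] max' by simp
    then have "det P < det ?M"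
      using det_midpoint_strict P(1) Q(1) \<open>P \<noteq> Q\<close> by blast
    \<comment> \<open>The image of \<open>x\<close> under the averaged pair is the midpoint of its
      two images, so convexity of \<open>K\<close> applies.\<close>
    moreover have "?M *v x + (1/2) *\<^sub>R (z + w) \<in> body K" if "x \<in> body L" for x
    proof -
      have "(1/2) *\<^sub>R (P *v x + z) + (1/2) *\<^sub>R (Q *v x + w) \<in> body K"
        using mem[OF that] by (intro convexD[OF convex_body]) auto
      also have "(1/2) *\<^sub>R (P *v x + z) + (1/2) *\<^sub>R (Q *v x + w) = ?M *v x + (1/2) *\<^sub>R (z + w)"
        by (simp add: scaleR_matrix_vector_assoc[symmetric] matrix_vector_mult_add_rdistrib scaleR_add_right)
      finally show ?thesis .
    qed
    then have "affine_image ?M ((1/2) *\<^sub>R (z + w)) (body L) \<subseteq> body K"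
      by (auto simp: affine_image_def)
    moreover have "?M \<in> pos_def_matrices"
      using P(1) Q(1) by (intro pos_def_scaleR pos_def_add_semidefinite pos_def_imp_semidefinite) auto
    ultimately show False
      using max by (metis not_le)
  qed
  moreover have "z = w"
  proof (rule ccontr)
    assume "z \<noteq> w"
    define u where "u = w - z"
    have u: "u \<noteq> 0" using \<open>z \<noteq> w\<close> by (simp add: u_def)
    obtain R where R: "R > 0" "body L \<subseteq> cball 0 R"
      by (rule body_subset_cball)
    \<comment> \<open>This size gives \<open>\<bar>t * (u \<bullet> x)\<bar> \<le> 1/2\<close> on
      \<open>L\<close>, so the parameter \<open>s\<close> below stays between 0 and 1.\<close>
    define t where "t = 1 / (2 * R * norm u)"
    have "t > 0" using u R by (simp add: t_def)
    define B where "B = t *\<^sub>R (\<chi> i j. u $ i * u $ j)"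
    have Bx: "B *v x = (t * (u \<bullet> x)) *\<^sub>R u" for x
      by (simp add: B_def scaleR_matrix_vector_assoc[symmetric] outer_product_mult)
    have B: "transpose B = B" "0 \<le> x \<bullet> (B *v x)" for x
    proof -
      show "transpose B = B"
        by (simp add: B_def transpose_def vec_eq_iff mult.commute)
      have "x \<bullet> (B *v x) = t * (u \<bullet> x)\<^sup>2"
        by (simp add: Bx inner_commute[of u x] power2_eq_square)
      then show "0 \<le> x \<bullet> (B *v x)"
        using \<open>t > 0\<close> by simp
    qed
    have "B \<noteq> 0"
    proof
      assume "B = 0"
      then show False using Bx[of u] u \<open>t > 0\<close> by simp
    qed
    then have "det P < det (P + B)"
      using det_add_semidefinite P(1) B by blast
    moreover have "P + B \<in> pos_def_matrices"
      using P(1) B by (intro pos_def_add_semidefinite) (auto simp: semidefinite_matrices_def)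
    moreover have "(P + B) *v x + (z + (1/2) *\<^sub>R u) \<in> body K" if "x \<in> body L" for x
    proof -
      \<comment> \<open>The perturbed image of \<open>x\<close> is the point with parameter
        \<open>s\<close> on the segment from \<open>P *v x + z\<close> to
        \<open>P *v x + w\<close>.\<close>
      define s where "s = 1/2 + t * (u \<bullet> x)"
      have "\<bar>u \<bullet> x\<bar> \<le> norm u * norm x"
        by (rule Cauchy_Schwarz_ineq2)
      also have "\<dots> \<le> norm u * R"
        using R(2) that by (intro mult_left_mono) auto
      finally have "t * \<bar>u \<bullet> x\<bar> \<le> t * (norm u * R)"
        using \<open>t > 0\<close> by simp
      also have "\<dots> = 1/2"
        using u R by (simp add: t_def)
      finally have "\<bar>t * (u \<bullet> x)\<bar> \<le> 1/2"
        using \<open>t > 0\<close> by (simp add: abs_mult)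
      then have "0 \<le> s" "s \<le> 1" unfolding s_def by linarith+
      then have "(1 - s) *\<^sub>R (P *v x + z) + s *\<^sub>R (P *v x + w) \<in> body K"
        using mem[OF that] \<open>P = Q\<close> by (intro convexD[OF convex_body]) auto
      also have "(1 - s) *\<^sub>R (P *v x + z) + s *\<^sub>R (P *v x + w) = P *v x + z + s *\<^sub>R u"
        by (simp add: u_def algebra_simps)
      also have "\<dots> = (P + B) *v x + (z + (1/2) *\<^sub>R u)"
        by (simp add: s_def matrix_vector_mult_add_rdistrib Bx scaleR_add_left)
      finally show ?thesis .
    qed
    then have "affine_image (P + B) (z + (1/2) *\<^sub>R u) (body L) \<subseteq> body K"
      by (auto simp: affine_image_def)
    ultimately show False
      using max by (metis not_le)
  qed
  ultimately show ?thesis by blast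
qed

subsection \<open>Continuity\<close>

text \<open>If a hyperplane separated \<open>x\<close> from \<open>K'\<close>, the point of the ball
  farthest from \<open>K'\<close> in the normal direction would be at distance at least
  \<open>e\<close> from \<open>K'\<close>.\<close>

lemma mem_body_if_deep_in_near_body:
  fixes K K' :: "'n::finite convex_body"
  assumes ball: "cball x e \<subseteq> body K" and dist: "dist K K' < e"
  shows "x \<in> body K'"
proof (rule ccontr)
  assume "x \<notin> body K'"
  then obtain a b where ab: "a \<bullet> x < b" "\<And>y. y \<in> body K' \<Longrightarrow> b < a \<bullet> y"
    using separating_hyperplane_closed_point[OF convex_body compact_imp_closed[OF compact_body]] by metis
  obtain y0 where "y0 \<in> body K'" using body_nonempty by blast
  then have "a \<noteq> 0" using ab(1) ab(2)[of y0] by auto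
  have "e > 0" using dist zero_le_dist[of K K'] by linarith
  define q where "q = x - (e / norm a) *\<^sub>R a"
  have "q \<in> cball x e"
    using \<open>a \<noteq> 0\<close> \<open>e > 0\<close> by (simp add: q_def dist_norm)
  then obtain y where y: "y \<in> body K'" "dist q y < e"
    using convex_body_approx[OF dist] ball by blast
  have "a \<bullet> y = a \<bullet> q + a \<bullet> (y - q)"
    by (simp add: inner_diff_right)
  also have "a \<bullet> (y - q) \<le> norm a * norm (y - q)"
    by (rule norm_cauchy_schwarz)
  also have "norm a * norm (y - q) \<le> norm a * e"
    using y(2) by (intro mult_left_mono) (auto simp: dist_norm norm_minus_commute)
  also have "a \<bullet> q + norm a * e = a \<bullet> x"
    using \<open>a \<noteq> 0\<close> by (simp add: q_def inner_diff_right dot_square_norm power2_eq_square)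
  finally show False
    using ab(1) ab(2)[OF y(1)] by simp
qed

text \<open>Contracting a positive image towards the centre of a ball inside \<open>K\<close> leaves a margin that
  absorbs small perturbations of both bodies.\<close>

lemma contracted_image_subset_eventually:
  fixes K L :: "'n::finite convex_body"
  assumes Ks: "Ks \<longlonglongrightarrow> K" and Ls: "Ls \<longlonglongrightarrow> L"
    and sub: "affine_image P z (body L) \<subseteq> body K" and t: "0 < t" "t < 1"
  shows "\<exists>w. \<forall>\<^sub>F k in sequentially. affine_image ((1 - t) *\<^sub>R P) w (body (Ls k)) \<subseteq> body (Ks k)"
proof -
  obtain c r where r: "r > 0" "cball c r \<subseteq> body K"
    by (rule body_contains_cball)
  obtain M where M: "M > 0" "\<And>x. norm (P *v x) \<le> norm x * M"
    using bounded_linear.pos_bounded[OF matrix_vector_mul_bounded_linear[of P]] by blast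
  let ?w = "(1 - t) *\<^sub>R z + t *\<^sub>R c"
  \<comment> \<open>The contraction leaves a margin \<open>t * r\<close>: one half absorbs the
    change of \<open>K\<close>, the other the change of \<open>L\<close> as enlarged by
    \<open>P\<close>.\<close>
  define e where "e = t * r / 2"
  have "e > 0" using t r by (simp add: e_def)
  have "\<forall>\<^sub>F k in sequentially. dist (Ks k) K < e"
    using Ks \<open>e > 0\<close> by (rule tendstoD)
  moreover have "\<forall>\<^sub>F k in sequentially. dist (Ls k) L < e / M"
    using Ls by (rule tendstoD) (use \<open>e > 0\<close> M in simp)
  ultimately have "\<forall>\<^sub>F k in sequentially. affine_image ((1 - t) *\<^sub>R P) ?w (body (Ls k)) \<subseteq> body (Ks k)"
  proof eventually_elim
    case (elim k)
    have "(1 - t) *\<^sub>R (P *v y) + ?w \<in> body (Ks k)" if y: "y \<in> body (Ls k)" for y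
    proof (rule mem_body_if_deep_in_near_body)
      show "dist K (Ks k) < e"
        using elim(1) by (simp add: dist_commute)
      obtain x where x: "x \<in> body L" "dist y x < e / M"
        using convex_body_approx[OF elim(2) y] by blast
      have "norm (P *v (y - x)) \<le> norm (y - x) * M"
        by (rule M(2))
      also have "\<dots> \<le> e"
        using x(2) M(1) by (simp add: dist_norm pos_less_divide_eq less_imp_le)
      finally have Pyx: "norm (P *v (y - x)) \<le> e" .
      show "cball ((1 - t) *\<^sub>R (P *v y) + ?w) e \<subseteq> body K"
      proof
        fix q assume "q \<in> cball ((1 - t) *\<^sub>R (P *v y) + ?w) e"
        define d where "d = q - ((1 - t) *\<^sub>R (P *v y) + ?w)"
        have d: "norm d \<le> e"
          using \<open>q \<in> _\<close> by (simp add: d_def dist_norm norm_minus_commute)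
        \<comment> \<open>Both errors are collected in \<open>v\<close> and charged to the centre:
          \<open>c + v /\<^sub>R t\<close> is still in the ball, and \<open>q\<close> is a convex
          combination of it and \<open>P *v x + z\<close>.\<close>
        define v where "v = d + (1 - t) *\<^sub>R (P *v (y - x))"
        have "norm v \<le> norm d + norm ((1 - t) *\<^sub>R (P *v (y - x)))"
          unfolding v_def by (rule norm_triangle_ineq)
        also have "norm ((1 - t) *\<^sub>R (P *v (y - x))) \<le> 1 * e"
          unfolding norm_scaleR using t Pyx by (intro mult_mono) auto
        finally have "norm v \<le> t * r"
          using d by (simp add: e_def)
        then have "c + v /\<^sub>R t \<in> cball c r"
          using t by (simp add: dist_norm field_simps)
        then have "c + v /\<^sub>R t \<in> body K"
          using r(2) by blast
        moreover have "P *v x + z \<in> body K"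
          using sub x(1) by (auto simp: affine_image_def)
        ultimately have "(1 - t) *\<^sub>R (P *v x + z) + t *\<^sub>R (c + v /\<^sub>R t) \<in> body K"
          using t by (intro convexD[OF convex_body]) auto
        also have "(1 - t) *\<^sub>R (P *v x + z) + t *\<^sub>R (c + v /\<^sub>R t) = q"
        proof -
          have tv: "t *\<^sub>R (v /\<^sub>R t) = v"
            using t by simp
          show ?thesis
            unfolding scaleR_add_right[of t] tv
            by (simp add: v_def d_def matrix_vector_mult_diff_distrib scaleR_add_right scaleR_diff_right)
        qed
        finally show "q \<in> body K" .
      qed
    qed
    then show ?case
      by (auto simp: affine_image_def scaleR_matrix_vector_assoc[symmetric])
  qed
  then show ?thesis by blast
qed

text \<open>A competitor for the limit bodies, contracted by \<open>1 - t\<close>, eventually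
  competes with \<open>Ps k\<close>. The determinant inequality passes to the limit in
  \<open>k\<close> and then in \<open>t\<close>.\<close>

lemma realizes_limit:
  fixes K L :: "'n::finite convex_body"
  assumes lim: "Ks \<longlonglongrightarrow> K" "Ls \<longlonglongrightarrow> L" "Ps \<longlonglongrightarrow> P" "zs \<longlonglongrightarrow> z"
    and real: "\<And>k. realizes_positive_John_image (Ks k) (Ls k) (Ps k, zs k)"
  shows "realizes_positive_John_image K L (P, z)"
proof -
  have Ps: "Ps k \<in> pos_def_matrices" "affine_image (Ps k) (zs k) (body (Ls k)) \<subseteq> body (Ks k)" for k
    using real[of k] by (auto simp: realizes_iff_det_maximal)
  have max: "det Q \<le> det (Ps k)"
    if "Q \<in> pos_def_matrices" "affine_image Q w (body (Ls k)) \<subseteq> body (Ks k)" for k Q w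
    using real[of k] that by (auto simp: realizes_iff_det_maximal)
  have P: "P \<in> semidefinite_matrices"
    using semidefinite_limit[OF lim(3)] Ps(1) pos_def_imp_semidefinite by blast
  have sub: "affine_image P z (body L) \<subseteq> body K"
    using lim Ps(2) by (rule affine_image_subset_limit)
  have le: "det Q \<le> det P"
    if Q: "Q \<in> pos_def_matrices" "affine_image Q w (body L) \<subseteq> body K" for Q w
  proof -
    have *: "(1 - t) ^ CARD('n) * det Q \<le> det P" if t: "0 < t" "t < 1" for t
    proof -
      obtain v where v: "\<forall>\<^sub>F k in sequentially. affine_image ((1 - t) *\<^sub>R Q) v (body (Ls k)) \<subseteq> body (Ks k)"
        using contracted_image_subset_eventually[OF lim(1,2) Q(2) t] by blast
      have "(1 - t) *\<^sub>R Q \<in> pos_def_matrices"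
        using Q(1) t by (intro pos_def_scaleR) auto
      with v have "\<forall>\<^sub>F k in sequentially. det ((1 - t) *\<^sub>R Q) \<le> det (Ps k)"
        by (auto elim!: eventually_mono intro: max)
      then have "det ((1 - t) *\<^sub>R Q) \<le> det P"
        by (intro tendsto_lowerbound[OF tendsto_det[OF lim(3)]]) auto
      then show ?thesis by (simp add: det_scaleR)
    qed
    \<comment> \<open>Letting \<open>t\<close> decrease to 0 removes the contraction factor.\<close>
    have "((\<lambda>t. (1 - t) ^ CARD('n) * det Q) \<longlongrightarrow> (1 - 0) ^ CARD('n) * det Q) (at_right 0)"
      by (intro tendsto_intros)
    moreover have "\<forall>\<^sub>F t in at_right 0. (1 - t) ^ CARD('n) * det Q \<le> det P"
      unfolding eventually_at_right_field by (intro exI[of _ 1]) (simp add: *)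
    ultimately show ?thesis
      using tendsto_upperbound[of "\<lambda>t. (1 - t) ^ CARD('n) * det Q" _ "at_right (0::real)"] by simp
  qed
  \<comment> \<open>A realizing pair of the limit bodies bounds \<open>det P\<close> below by a
    positive number, so the limit matrix cannot degenerate.\<close>
  obtain Q w where "realizes_positive_John_image K L (Q, w)"
    using realizes_exists by blast
  then have "0 < det P"
    using le[of Q w] det_pos_def[of Q] by (auto simp: realizes_iff_det_maximal)
  then have "P \<in> pos_def_matrices"
    using P by (intro semidefinite_imp_pos_def) auto
  then show ?thesis
    using sub le by (auto simp: realizes_iff_det_maximal)
qed

text \<open>Eventually \<open>Ls k\<close> contains a fixed ball of half the radius and
  \<open>Ks k\<close> lies in a slightly larger fixed ball, so
  \<open>affine_image_norm_bound\<close> applies uniformly.\<close>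

lemma positive_images_eventually_bounded:
  fixes K L :: "'n::finite convex_body"
  assumes Ks: "Ks \<longlonglongrightarrow> K" and Ls: "Ls \<longlonglongrightarrow> L"
  shows "\<exists>M. \<forall>\<^sub>F k in sequentially. \<forall>P z. affine_image P z (body (Ls k)) \<subseteq> body (Ks k) \<longrightarrow> norm (P, z) \<le> M"
proof -
  obtain c r where r: "r > 0" "cball c r \<subseteq> body L"
    by (rule body_contains_cball)
  obtain R where R: "R > 0" "body K \<subseteq> cball 0 R"
    by (rule body_subset_cball)
  have "r / 2 > 0" using r by simp
  obtain M where M: "\<And>(P::real^'n^'n) z L. cball c (r / 2) \<subseteq> L \<Longrightarrow>
      affine_image P z L \<subseteq> cball 0 (R + 1) \<Longrightarrow> norm (P, z) \<le> M"
    using affine_image_norm_bound[OF \<open>r / 2 > 0\<close>, of c "R + 1"] by blast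
  have "\<forall>\<^sub>F k in sequentially. dist (Ks k) K < 1"
    using Ks by (rule tendstoD) simp
  moreover have "\<forall>\<^sub>F k in sequentially. dist (Ls k) L < r / 2"
    using Ls \<open>r / 2 > 0\<close> by (rule tendstoD)
  ultimately have "\<forall>\<^sub>F k in sequentially. \<forall>P z. affine_image P z (body (Ls k)) \<subseteq> body (Ks k) \<longrightarrow> norm (P, z) \<le> M"
  proof eventually_elim
    case (elim k)
    have "cball c (r / 2) \<subseteq> body (Ls k)"
    proof
      fix x assume x: "x \<in> cball c (r / 2)"
      show "x \<in> body (Ls k)"
      proof (rule mem_body_if_deep_in_near_body)
        have "cball x (r / 2) \<subseteq> cball c r"
          using x by (simp add: cball_subset_cball_iff dist_commute)
        then show "cball x (r / 2) \<subseteq> body L"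
          using r(2) by blast
        show "dist L (Ls k) < r / 2"
          using elim(2) by (simp add: dist_commute)
      qed
    qed
    moreover have "body (Ks k) \<subseteq> cball 0 (R + 1)"
    proof
      fix x assume "x \<in> body (Ks k)"
      then obtain y where "y \<in> body K" "dist x y < 1"
        using convex_body_approx[OF elim(1)] by blast
      moreover from this have "norm y \<le> R" using R(2) by auto
      ultimately show "x \<in> cball 0 (R + 1)"
        using norm_triangle_sub[of x y] by (simp add: dist_norm)
    qed
    ultimately show ?case
      using M by (meson order_trans)
  qed
  then show ?thesis by blast
qed

section \<open>The John map and its sequential continuity\<close>

lemma realizes_ex1: "\<exists>!Pz. realizes_positive_John_image K L Pz"
proof -
  obtain P z where Pz: "realizes_positive_John_image K L (P, z)"
    using realizes_exists by blast
  show ?thesis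
  proof (rule ex1I)
    show "Qw = (P, z)" if "realizes_positive_John_image K L Qw" for Qw
      using realizes_unique[OF _ Pz] that by (cases Qw) auto
  qed (rule Pz)
qed

lemma realizes_iff_positive_John_map:
  "realizes_positive_John_image K L Pz \<longleftrightarrow> positive_John_map (K, L) = Pz"
proof
  assume "realizes_positive_John_image K L Pz"
  then show "positive_John_map (K, L) = Pz"
    by (simp add: positive_John_map_def the1_equality[OF realizes_ex1])
next
  assume "positive_John_map (K, L) = Pz"
  then show "realizes_positive_John_image K L Pz"
    using theI'[OF realizes_ex1[of K L]] by (simp add: positive_John_map_def)
qed

text \<open>A subsequence of values staying away from \<open>positive_John_map X\<close> is
  eventually bounded, so it has a convergent subsequence; its limit is realizing for
  \<open>X\<close> and hence equals that value.\<close>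

lemma positive_John_map_sequentially:
  fixes Xs :: "nat \<Rightarrow> 'n::finite convex_body \<times> 'n convex_body"
  assumes Xs: "Xs \<longlonglongrightarrow> X"
  shows "(\<lambda>k. positive_John_map (Xs k)) \<longlonglongrightarrow> positive_John_map X"
proof (rule ccontr)
  let ?f = "positive_John_map :: 'n convex_body \<times> 'n convex_body \<Rightarrow> _"
  assume "\<not> ?thesis"
  then obtain e where e: "e > 0" "\<not> (\<forall>\<^sub>F k in sequentially. dist (?f (Xs k)) (?f X) < e)"
    by (auto simp: tendsto_iff)
  obtain r :: "nat \<Rightarrow> nat" where r: "strict_mono r" "\<forall>k. \<not> dist (?f (Xs (r k))) (?f X) < e"
    using not_eventually_sequentiallyD[OF e(2)] by (elim exE conjE) (rule that)
  have f: "realizes_positive_John_image (fst Y) (snd Y) (fst (?f Y), snd (?f Y))" for Y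
    by (simp add: realizes_iff_positive_John_map)
  have Xs_fst: "(\<lambda>k. fst (Xs k)) \<longlonglongrightarrow> fst X" and Xs_snd: "(\<lambda>k. snd (Xs k)) \<longlonglongrightarrow> snd X"
    using Xs by (auto intro: tendsto_fst tendsto_snd)
  obtain M N where "\<And>k P z. k \<ge> N \<Longrightarrow>
      affine_image P z (body (snd (Xs k))) \<subseteq> body (fst (Xs k)) \<Longrightarrow> norm (P, z) \<le> M"
    using positive_images_eventually_bounded[OF Xs_fst Xs_snd] unfolding eventually_sequentially by blast
  then have bound: "norm (?f (Xs k)) \<le> M" if "k \<ge> N" for k
    using f[of "Xs k"] that unfolding realizes_iff_det_maximal by (metis prod.collapse)
  \<comment> \<open>The shift by \<open>N\<close> brings every index into the range where the bound
    holds, since \<open>r j \<ge> j\<close>.\<close>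
  have "?f (Xs (r (k + N))) \<in> cball 0 M" for k
    using bound[of "r (k + N)"] seq_suble[OF r(1), of "k + N"] by simp
  then obtain l s where s: "strict_mono s" "((\<lambda>k. ?f (Xs (r (k + N)))) \<circ> s) \<longlonglongrightarrow> l"
    using compact_cball[of 0 M] unfolding compact_def by meson
  define q where "q k = r (s k + N)" for k
  have "strict_mono q"
    using r(1) s(1) by (auto simp: q_def strict_mono_def)
  have q: "(\<lambda>k. ?f (Xs (q k))) \<longlonglongrightarrow> l"
    using s(2) by (simp add: q_def o_def)
  have "realizes_positive_John_image (fst X) (snd X) (fst l, snd l)"
  proof (rule realizes_limit)
    show "(\<lambda>k. fst (Xs (q k))) \<longlonglongrightarrow> fst X" "(\<lambda>k. snd (Xs (q k))) \<longlonglongrightarrow> snd X"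
      using LIMSEQ_subseq_LIMSEQ[OF Xs_fst \<open>strict_mono q\<close>] LIMSEQ_subseq_LIMSEQ[OF Xs_snd \<open>strict_mono q\<close>]
      by (simp_all add: o_def)
    show "(\<lambda>k. fst (?f (Xs (q k)))) \<longlonglongrightarrow> fst l" "(\<lambda>k. snd (?f (Xs (q k)))) \<longlonglongrightarrow> snd l"
      using q by (auto intro: tendsto_fst tendsto_snd)
  qed (rule f)
  then have "l = ?f X"
    by (simp add: realizes_iff_positive_John_map)
  then have "\<forall>\<^sub>F k in sequentially. dist (?f (Xs (q k))) (?f X) < e"
    using tendstoD[OF q e(1)] by simp
  then show False
    using r(2) by (auto simp: q_def)
qed

theorem proposition3p8:
  shows "(\<forall>K L :: 'n::finite convex_body. \<exists>!Pz. realizes_positive_John_image K L Pz) \<and>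
         continuous_on UNIV
           (positive_John_map :: 'n convex_body \<times> 'n convex_body \<Rightarrow> (real^'n^'n) \<times> (real^'n))"
  by (simp add: realizes_ex1 continuous_on_sequentially o_def positive_John_map_sequentially)

end
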